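(* There exist infinitely many multiplier sections of period $1$.
   Context: Let $\widehat{\mathbb{C}}$ be the Riemann sphere. For a positive integer $N$, a multiplier section of period $N$ is a triple $(a,b,z_1)$ of holomorphic functions $a,b,z_1:\widehat{\mathbb{C}}\to\widehat{\mathbb{C}}$ in the variable $\lambda$ (not identically $\infty$, i.e. elements of the rational function field $\mathbb{C}(\lambda)$) such that $z_1$ is a point of exact period $N$ for the polynomial $f(z)=z^3+az+b\in\mathbb{C}(\lambda)[z]$ (that is, $f^N(z_1)=z_1$ and $N$ is the least positive integer with this property, where $f^N$ is the $N$-fold iterate), and the multiplier $(f^N)'(z_1)$ is equal to $\lambda$. *)

theory Defs
  imports "HOL-Computational_Algebra.Fraction_Field" "HOL-Computational_Algebra.Polynomial" Complex_Main
begin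

(* The field C(\<lambda>). Its elements are the holomorphic self-maps of the Riemann sphere
   other than the constant map \<infinity>. *)
type_synonym ratfun = "complex poly fract"

definition lam :: ratfun where
  "lam = Fraction_Field.Fract [:0, 1:] 1"

definition cubic :: "ratfun \<Rightarrow> ratfun \<Rightarrow> ratfun poly" where
  "cubic a b = monom 1 3 + smult a (monom 1 1) + [:b:]"

(* The iterate is itself a polynomial in z, so that the multiplier below is the value of its
   formal derivative with respect to z. *)
definition poly_iter :: "nat \<Rightarrow> 'a::comm_ring_1 poly \<Rightarrow> 'a poly" where
  "poly_iter n p = (pcompose p ^^ n) [:0, 1:]"

lemma poly_poly_iter: "poly (poly_iter n p) x = (poly p ^^ n) x"
  by (induction n) (simp_all add: poly_iter_def poly_pcompose)

definition exact_period :: "nat \<Rightarrow> ratfun poly \<Rightarrow> ratfun \<Rightarrow> bool" where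
  "exact_period N f z \<longleftrightarrow>
     N > 0 \<and> poly (poly_iter N f) z = z \<and> (\<forall>m. 0 < m \<and> m < N \<longrightarrow> poly (poly_iter m f) z \<noteq> z)"

definition multiplier :: "nat \<Rightarrow> ratfun poly \<Rightarrow> ratfun \<Rightarrow> ratfun" where
  "multiplier N f z = poly (pderiv (poly_iter N f)) z"

definition multiplier_section :: "nat \<Rightarrow> ratfun \<times> ratfun \<times> ratfun \<Rightarrow> bool" where
  "multiplier_section N = (\<lambda>(a, b, z\<^sub>1).
     exact_period N (cubic a b) z\<^sub>1 \<and> multiplier N (cubic a b) z\<^sub>1 = lam)"

end

theory Submission imports Defs begin

lemma poly_iter_1: "poly_iter 1 p = p"
  by (simp add: poly_iter_def pcompose_idR)

text \<open>For period 1 the minimality condition is vacuous and the iterate is the cubic itself, so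
  only the fixed point equation and the value of the derivative at \<open>z\<close> remain.\<close>

lemma multiplier_section_1_iff:
  "multiplier_section 1 (a, b, z) \<longleftrightarrow> z ^ 3 + a * z + b = z \<and> 3 * z\<^sup>2 + a = lam"
proof -
  have "multiplier 1 (cubic a b) z = 3 * z\<^sup>2 + a"
    unfolding multiplier_def poly_iter_1
    by (simp add: cubic_def pderiv_add pderiv_smult pderiv_monom poly_monom pderiv_pCons)
  then show ?thesis
    by (auto simp: multiplier_section_def exact_period_def poly_iter_1 [unfolded One_nat_def]
      cubic_def poly_monom)
qed

text \<open>The constant functions already form a copy of the infinite field of complex
  numbers.\<close>

lemma infinite_ratfun: "infinite (UNIV :: ratfun set)"
proof -
  have "inj (\<lambda>c::complex. Fraction_Field.Fract [:c:] 1)"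
    by (rule injI) (simp add: eq_fract)
  then show ?thesis
    using infinite_UNIV_char_0 [where 'a = complex] finite_imageD finite_subset subset_UNIV by metis
qed

text \<open>Any \<open>z\<close> is the fixed point of a multiplier section: the multiplier condition determines \<open>a\<close>,
  and then the fixed point equation determines \<open>b\<close>.\<close>

theorem theorem1: "infinite {s. multiplier_section 1 s}"
proof
  assume fin: "finite {s. multiplier_section 1 s}"
  define s where "s z = (lam - 3 * z\<^sup>2, z - z ^ 3 - (lam - 3 * z\<^sup>2) * z, z)" for z :: ratfun
  have "range s \<subseteq> {s. multiplier_section 1 s}"
    unfolding s_def by (auto simp: multiplier_section_1_iff simp del: One_nat_def)
  \<comment> \<open>The last component of \<open>s z\<close> is \<open>z\<close> itself, so distinct
    fixed points give distinct sections.\<close>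
  moreover have "inj s"
    by (rule injI) (simp add: s_def)
  ultimately show False
    using fin infinite_ratfun finite_subset finite_imageD by metis
qed

end
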